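(* There are no $\{2,3\}$-Diophantine quadruples.
   Context: For a finite set $S$ of primes, a positive integer is an $S$-unit if all its prime factors lie in $S$. A quadruple $(a_1,a_2,a_3,a_4)$ of positive, pairwise distinct integers is called an $S$-Diophantine quadruple if $a_ia_j+1$ is an $S$-unit for all $i\neq j$. *)

theory Defs
  imports "HOL-Computational_Algebra.Primes"
begin

text \<open>
  Both notions are meant for a finite set \<open>S\<close> of primes.
  The positivity conjunct in \<open>S_unit\<close> is needed because \<open>prime_factors 0 = {}\<close>.
\<close>

definition S_unit :: "nat set \<Rightarrow> nat \<Rightarrow> bool" where
  "S_unit S n \<longleftrightarrow> n > 0 \<and> prime_factors n \<subseteq> S"

definition S_Diophantine_quadruple :: "nat set \<Rightarrow> nat list \<Rightarrow> bool" where
  "S_Diophantine_quadruple S as \<longleftrightarrow>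
     length as = 4 \<and> (\<forall>a\<in>set as. a > 0) \<and> distinct as \<and>
     (\<forall>i<4. \<forall>j<4. i \<noteq> j \<longrightarrow> S_unit S (as ! i * as ! j + 1))"

end

theory Submission
  imports Defs
begin

text \<open>
  Modulo 3 and modulo 4 no three of the numbers have all pairwise products congruent to -1, whereas
  each product is -1 modulo 3 or modulo 4. So the four numbers represent the classes 1, 5, 7, 11
  modulo 12, and the three ways to split the quadruple into two pairs yield two values
  \<open>2 \<cdot> 2\<^sup>x\<close>, two values \<open>2 \<cdot> 3\<^sup>y\<close> and two mixed values \<open>2 \<cdot> 2\<^sup>x \<cdot> 3\<^sup>y\<close>. From here on the primes
  may be replaced by any coprime \<open>p, q > 1\<close>. Let \<open>a < b < c < d\<close>. Since \<open>ud + 1\<close> never divides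
  \<open>vd + 1\<close> for \<open>u < v < d\<close>, the prime power parts of the mixed value at \<open>d\<close> divide differences of
  smaller elements, which is only possible if the mixed pairs are \<open>ad\<close> and \<open>bc\<close>. Comparing
  valuations in \<open>ab \<cdot> cd = ac \<cdot> bd = ad \<cdot> bc\<close> shows that \<open>ab + 1\<close> divides \<open>ad + 1\<close>, which divides
  \<open>bc + 1\<close>. The quotients of \<open>ad + 1\<close> and \<open>bc + 1\<close> by \<open>ab + 1\<close> are 1 modulo \<open>a\<close> and \<open>b\<close>
  respectively, and this forces them to be larger than the divisors of \<open>b - a\<close> and \<open>d - b\<close> permit.
\<close>

section \<open>Divisibility between values that share a factor\<close>

text \<open>Eliminating \<open>c\<close> from the two values leaves \<open>v - u\<close>, which is
  positive but smaller than \<open>u * c + 1\<close>.\<close>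

lemma mult_plus_one_not_dvd:
  fixes u v c :: int
  assumes "0 < u" "u < v" "v < c"
  shows "\<not> u * c + 1 dvd v * c + 1"
proof
  assume "u * c + 1 dvd v * c + 1"
  then have "u * c + 1 dvd v * (u * c + 1) - u * (v * c + 1)"
    by (intro dvd_diff dvd_mult) auto
  then have "u * c + 1 dvd v - u" by (simp add: algebra_simps)
  then have "u * c + 1 \<le> v - u" using assms by (intro zdvd_imp_le) auto
  moreover have "c \<le> u * c" using assms by simp
  ultimately show False using assms by linarith
qed

lemma dvd_diff_of_dvd_mult_plus_one:
  fixes u v c m :: int
  assumes "m dvd u * c + 1" "m dvd v * c + 1"
  shows "m dvd u - v"
proof -
  have "m dvd u * (v * c + 1) - v * (u * c + 1)" using assms by (intro dvd_diff dvd_mult)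
  then show ?thesis by (simp add: algebra_simps)
qed

text \<open>Powers of \<open>p\<close> form a chain under divisibility: \<open>A <= E\<close> would
  make \<open>u * c + 1\<close> divide \<open>v * c + 1\<close>, which forces \<open>u < v\<close>
  and contradicts \<open>mult_plus_one_not_dvd\<close>.\<close>

lemma power_part_dvd_diff:
  fixes u v c p :: int
  assumes "0 < u" "0 < v" "u < c" "v < c" "u \<noteq> v"
    and u: "u * c + 1 = 2 * p ^ A" and v: "2 * p ^ E dvd v * c + 1"
  shows "E < A" "2 * p ^ E dvd u - v"
proof -
  show "E < A"
  proof (rule ccontr)
    assume "\<not> E < A"
    then have "2 * p ^ A dvd 2 * p ^ E" by (simp add: le_imp_power_dvd)
    then have dvd: "u * c + 1 dvd v * c + 1" using u v by (metis dvd_trans)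
    have pos: "0 < v * c + 1" using assms by (simp add: add_pos_pos)
    have "u * c + 1 \<le> v * c + 1" using dvd pos by (rule zdvd_imp_le)
    then have "u * c \<le> v * c" by simp
    then have "u < v" using assms(1,3,5) by simp
    then show False using dvd mult_plus_one_not_dvd assms by blast
  qed
  then have "2 * p ^ E dvd u * c + 1" by (simp add: u le_imp_power_dvd)
  then show "2 * p ^ E dvd u - v" using v by (rule dvd_diff_of_dvd_mult_plus_one)
qed

text \<open>The parts \<open>2 * p ^ E\<close> and \<open>2 * q ^ F\<close> divide nonzero
  differences, and their product is twice the mixed value. The bound restricts the position of the
  mixed pairs and later orders the two mixed values.\<close>

lemma mixed_value_bound:
  fixes u v w d p q :: int
  assumes "0 < u" "0 < v" "0 < w" "u < d" "v < d" "w < d" "u \<noteq> w" "v \<noteq> w"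
    and "p > 1" "q > 1"
    and u: "u * d + 1 = 2 * p ^ A" and v: "v * d + 1 = 2 * q ^ C"
    and w: "w * d + 1 = 2 * p ^ E * q ^ F"
  shows "2 * (w * d + 1) \<le> \<bar>u - w\<bar> * \<bar>v - w\<bar>"
proof -
  have "2 * p ^ E dvd u - w" "2 * q ^ F dvd v - w"
    using power_part_dvd_diff(2)[OF _ _ _ _ _ u] power_part_dvd_diff(2)[OF _ _ _ _ _ v] assms
    by simp_all
  then have "2 * p ^ E \<le> \<bar>u - w\<bar>" "2 * q ^ F \<le> \<bar>v - w\<bar>"
    using assms by (auto intro!: zdvd_imp_le)
  then have "(2 * p ^ E) * (2 * q ^ F) \<le> \<bar>u - w\<bar> * \<bar>v - w\<bar>"
    using assms by (intro mult_mono) auto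
  then show ?thesis by (simp add: w)
qed

section \<open>Contradiction when the mixed pairs are \<open>ad\<close> and
  \<open>bc\<close>\<close>

text \<open>The hypothesis on \<open>x, y, z, w\<close> is \<open>(2x - 1)(2y - 1) = (2z - 1)(2w - 1)\<close>.\<close>

lemma dvd_of_product_identity:
  fixes x y z w m :: int
  assumes "2 * x * y - x - y = 2 * z * w - z - w" "m dvd y" "m dvd z" "m dvd w"
  shows "m dvd x"
proof -
  have "x = 2 * x * y - y - 2 * z * w + z + w" using assms(1) by simp
  moreover have "m dvd 2 * x * y - y - 2 * z * w + z + w"
    using assms by (intro dvd_add dvd_diff) auto
  ultimately show ?thesis by simp
qed

lemma not_power_Suc_dvd_coprime_mult:
  fixes p q :: int
  assumes "coprime p q" "p > 1"
  shows "\<not> p ^ Suc e dvd p ^ e * q ^ f"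
proof
  assume "p ^ Suc e dvd p ^ e * q ^ f"
  then have "p dvd q ^ f" using assms by (simp add: mult.commute)
  moreover have "coprime p (q ^ f)" using assms by simp
  ultimately have "is_unit p" by (meson coprime_common_divisor dvd_refl)
  then show False using assms by simp
qed

text \<open>Since \<open>M\<close> is 1 modulo \<open>a\<close> and \<open>k * M\<close> is 1 modulo
  \<open>b\<close>, there are quotients \<open>n\<close> and \<open>l\<close>, and divisibility
  gives \<open>k <= n <= l\<close>. But \<open>2 * M <= b - a\<close> forces
  \<open>2 * l < k\<close>.\<close>

lemma no_divisor_chain:
  fixes a b c d k M :: int
  assumes pos: "0 < a" "a < b" "b < d" "k > 0" "M > 0"
    and ad: "a * d + 1 = (a * b + 1) * M"
    and bc: "b * c + 1 = k * ((a * b + 1) * M)"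
    and M: "2 * M dvd b - a" and k: "k * (a * b + 1) dvd d - b"
  shows False
proof -
  define n where "n = d - b * M"
  define l where "l = c - k * a * M"
  have n: "M = 1 + a * n" using ad by (simp add: n_def algebra_simps)
  have l: "k * M = 1 + b * l" using bc by (simp add: l_def algebra_simps)
  have ab: "a * b + 1 > 0" using pos by (simp add: add_pos_pos)
  have "d = b * M + n" by (simp add: n_def)
  then have db: "d - b = n * (a * b + 1)" using n by (simp add: algebra_simps)
  then have "k dvd n" using k ab by simp
  have "0 < n * (a * b + 1)" using pos by (simp flip: db)
  then have n_pos: "n > 0" using ab by (simp add: zero_less_mult_iff)
  have "k \<le> n" using \<open>k dvd n\<close> n_pos by (rule zdvd_imp_le)
  have "M > 1" using n n_pos pos by simp
  moreover have "M \<le> k * M" using pos by simp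
  ultimately have "b * l > 0" using l by linarith
  then have l_pos: "l > 0" using pos by (simp add: zero_less_mult_iff)
  have "M dvd b - a" using M by (rule dvd_mult_right)
  \<comment> \<open>Subtracting \<open>(b - a) * l\<close> from \<open>k * M = 1 + b * l\<close>
    replaces \<open>b\<close> by \<open>a\<close> and keeps divisibility by
    \<open>M\<close>.\<close>
  then have "M dvd k * M - (b - a) * l" by (intro dvd_diff) auto
  then have "M dvd 1 + a * l" using l by (simp add: algebra_simps)
  then have "M \<le> 1 + a * l" using pos l_pos by (intro zdvd_imp_le) (auto simp: add_pos_pos)
  then have "n \<le> l" using n pos by simp
  have "2 * M \<le> b - a" using M pos by (intro zdvd_imp_le) auto
  then have "2 * M * l \<le> b * l" using pos l_pos by (intro mult_right_mono) auto
  then have "M * (2 * l) < M * k" using l by (simp add: ac_simps)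
  then have "2 * l < k" using pos by simp
  then show False using \<open>k \<le> n\<close> \<open>n \<le> l\<close> l_pos by linarith
qed

text \<open>General coprime bases let one statement cover both ways of assigning 2 and 3 to the
  pairs.\<close>

lemma no_coprime_quadruple:
  fixes a b c d p q :: int
  assumes pq: "coprime p q" "p > 1" "q > 1"
    and ord: "0 < a" "a < b" "b < c" "c < d"
    and ab: "a * b + 1 = 2 * p ^ A" and cd: "c * d + 1 = 2 * p ^ B"
    and ac: "a * c + 1 = 2 * q ^ C" and bd: "b * d + 1 = 2 * q ^ D"
    and ad: "a * d + 1 = 2 * p ^ E * q ^ F" and bc: "b * c + 1 = 2 * p ^ G * q ^ H"
  shows False
proof -
  have qp: "coprime q p" using pq by (simp add: coprime_commute)
  have F: "2 * q ^ F dvd a * d + 1"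
    and G: "2 * p ^ G dvd b * c + 1" and H: "2 * q ^ H dvd b * c + 1"
    unfolding ad bc by simp_all
  have FD: "2 * q ^ F dvd b - a"
    using power_part_dvd_diff(2)[OF _ _ _ _ _ bd F] ord by simp
  have HC: "H < C"
    using power_part_dvd_diff(1)[OF _ _ _ _ _ ac H] ord by simp
  \<comment> \<open>Here \<open>d\<close> exceeds the common factor \<open>c\<close>, so
    \<open>power_part_dvd_diff\<close> does not apply; comparing sizes gives \<open>G < B\<close>
    instead.\<close>
  have "b * c < c * d" using ord by (simp add: mult.commute)
  moreover have "2 * p ^ G \<le> b * c + 1" using G ord by (intro zdvd_imp_le) (auto simp: add_pos_pos)
  ultimately have "p ^ G < p ^ B" using cd by simp
  then have "G < B" using pq by simp
  then have "2 * p ^ G dvd d * c + 1" using cd by (simp add: le_imp_power_dvd mult.commute)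
  then have Gdb: "2 * p ^ G dvd d - b" using G by (rule dvd_diff_of_dvd_mult_plus_one)
  have "a * b < c * d" "a * c < b * d" using ord by (simp_all add: mult_strict_mono)
  then have "p ^ A < p ^ B" "q ^ C < q ^ D" using ab cd ac bd by simp_all
  then have AB: "A < B" and CD: "C < D" using pq by simp_all
  have prod: "(a * d) * (b * c) = (a * c) * (b * d)" "(a * d) * (b * c) = (a * b) * (c * d)"
    by simp_all
  have "a * b = 2 * p ^ A - 1" "c * d = 2 * p ^ B - 1" "a * c = 2 * q ^ C - 1"
    "b * d = 2 * q ^ D - 1" "a * d = 2 * (p ^ E * q ^ F) - 1" "b * c = 2 * (p ^ G * q ^ H) - 1"
    using ab cd ac bd ad bc by simp_all
  note prod' = prod[unfolded this]
  define x where "x = p ^ E * q ^ F"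
  define y where "y = p ^ G * q ^ H"
  have eq_q: "2 * x * y - x - y = 2 * q ^ C * q ^ D - q ^ C - q ^ D"
    using prod'(1) unfolding x_def [symmetric] y_def [symmetric] by (simp add: algebra_simps)
  have eq_p: "2 * x * y - x - y = 2 * p ^ A * p ^ B - p ^ A - p ^ B"
    using prod'(2) unfolding x_def [symmetric] y_def [symmetric] by (simp add: algebra_simps)

  \<comment> \<open>If \<open>F < H\<close>, then \<open>q ^ Suc F\<close> divides \<open>y\<close>,
    \<open>q ^ C\<close> and \<open>q ^ D\<close>, hence also \<open>x\<close>, which contains
    \<open>q\<close> only to the power \<open>F\<close>. The case \<open>H < F\<close> is
    symmetric.\<close>
  have "\<not> F < H"
  proof
    assume "F < H"
    have "q ^ Suc F dvd x"
      by (rule dvd_of_product_identity[OF eq_q])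
        (use \<open>F < H\<close> HC CD in \<open>auto simp: y_def simp del: power_Suc intro!: le_imp_power_dvd dvd_mult\<close>)
    then show False using not_power_Suc_dvd_coprime_mult[OF qp pq(3), of F E]
      by (simp add: x_def mult.commute del: power_Suc)
  qed
  moreover have "\<not> H < F"
  proof
    assume "H < F"
    have "2 * y * x - y - x = 2 * q ^ C * q ^ D - q ^ C - q ^ D"
      using eq_q by (simp add: algebra_simps)
    then have "q ^ Suc H dvd y"
      by (rule dvd_of_product_identity)
        (use \<open>H < F\<close> HC CD in \<open>auto simp: x_def simp del: power_Suc intro!: le_imp_power_dvd dvd_mult\<close>)
    then show False using not_power_Suc_dvd_coprime_mult[OF qp pq(3), of H G]
      by (simp add: y_def mult.commute del: power_Suc)
  qed
  ultimately have FH: "F = H" by simp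

  \<comment> \<open>With equal \<open>q\<close>-parts, the order of the mixed values decides the
    order of \<open>E\<close> and \<open>G\<close>.\<close>
  have "2 * (a * d + 1) \<le> \<bar>c - a\<bar> * \<bar>b - a\<bar>"
    using ord pq cd bd ad by (intro mixed_value_bound[where p = p and q = q]) auto
  also have "\<dots> \<le> c * b" using ord by (intro mult_mono) auto
  finally have "2 * (a * d) + 2 \<le> b * c" by (simp add: algebra_simps)
  moreover have "0 < a * d" using ord by simp
  ultimately have "a * d + 1 < b * c + 1" by linarith
  then have "p ^ E < p ^ G" unfolding ad bc FH using pq by simp
  then have EG: "E < G" using pq by simp

  \<comment> \<open>Of the exponents \<open>A\<close>, \<open>B\<close>, \<open>E\<close>,
    \<open>G\<close> of \<open>p\<close>, a strict minimum attained only once is impossible by the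
    product identity; since \<open>A < B\<close> and \<open>E < G\<close>, this leaves
    \<open>A = E\<close>.\<close>
  have "\<not> A < E"
  proof
    assume "A < E"
    have "p ^ Suc A dvd p ^ A"
      by (rule dvd_of_product_identity[OF eq_p[symmetric]])
        (use \<open>A < E\<close> EG AB in \<open>auto simp: x_def y_def simp del: power_Suc intro!: le_imp_power_dvd dvd_mult2\<close>)
    then show False using not_power_Suc_dvd_coprime_mult[OF pq(1,2), of A 0]
      by (simp del: power_Suc)
  qed
  moreover have "\<not> E < A"
  proof
    assume "E < A"
    have "p ^ Suc E dvd x"
      by (rule dvd_of_product_identity[OF eq_p])
        (use \<open>E < A\<close> EG AB in \<open>auto simp: y_def simp del: power_Suc intro!: le_imp_power_dvd dvd_mult2\<close>)
    then show False using not_power_Suc_dvd_coprime_mult[OF pq(1,2)]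
      by (simp add: x_def del: power_Suc)
  qed
  ultimately have AE: "A = E" by simp

  have G': "p ^ G = p ^ (G - E) * p ^ E" using EG by (simp flip: power_add)
  \<comment> \<open>Now \<open>a * b + 1\<close> is the full \<open>p\<close>-part of
    \<open>a * d + 1\<close>, including the factor 2, and \<open>k * (a * b + 1)\<close> is
    \<open>2 * p ^ G\<close>.\<close>
  show False
  proof (rule no_divisor_chain[of a b d "p ^ (G - E)" "q ^ F" c])
    show "a * d + 1 = (a * b + 1) * q ^ F" by (simp add: ad ab AE)
    show "b * c + 1 = p ^ (G - E) * ((a * b + 1) * q ^ F)" by (simp add: bc ab AE FH G')
    show "p ^ (G - E) * (a * b + 1) dvd d - b" using Gdb by (simp add: ab AE G' mult.left_commute)
  qed (use ord pq FD in auto)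
qed

section \<open>Residues modulo 3 and modulo 4\<close>

lemma not_dvd_of_dvd_mult_plus_one:
  fixes m n u v :: int
  assumes "n dvd u * v + 1" "m dvd n" "\<not> is_unit m"
  shows "\<not> m dvd u"
proof
  assume "m dvd u"
  then have "m dvd u * v" by simp
  moreover have "m dvd u * v + 1" using assms(2,1) by (rule dvd_trans)
  ultimately show False using assms(3) dvd_add_right_iff by blast
qed

lemma three_dvd_mult_plus_one_iff:
  fixes u v :: int
  assumes "\<not> 3 dvd u" "\<not> 3 dvd v"
  shows "3 dvd u * v + 1 \<longleftrightarrow> u mod 3 \<noteq> v mod 3"
proof -
  have "u mod 3 = 1 \<or> u mod 3 = 2" "v mod 3 = 1 \<or> v mod 3 = 2" using assms by presburger+
  moreover have "(u * v + 1) mod 3 = ((u mod 3) * (v mod 3) + 1) mod 3" by (metis mod_add_left_eq mod_mult_eq)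
  ultimately show ?thesis unfolding dvd_eq_mod_eq_0 by auto
qed

lemma four_dvd_mult_plus_one_iff:
  fixes u v :: int
  assumes "odd u" "odd v"
  shows "4 dvd u * v + 1 \<longleftrightarrow> u mod 4 \<noteq> v mod 4"
proof -
  have "u mod 4 = 1 \<or> u mod 4 = 3" "v mod 4 = 1 \<or> v mod 4 = 3" using assms by presburger+
  moreover have "(u * v + 1) mod 4 = ((u mod 4) * (v mod 4) + 1) mod 4" by (metis mod_add_left_eq mod_mult_eq)
  ultimately show ?thesis unfolding dvd_eq_mod_eq_0 by auto
qed

text \<open>Pigeonhole: all three numbers are prime to 3, so two of them share a residue and their
  product is 1 modulo 3. Odd residues modulo 4 behave the same way.\<close>

lemma three_dvd_triangle:
  fixes u v w :: int
  shows "\<not> (3 dvd u * v + 1 \<and> 3 dvd v * w + 1 \<and> 3 dvd u * w + 1)"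
proof
  assume *: "3 dvd u * v + 1 \<and> 3 dvd v * w + 1 \<and> 3 dvd u * w + 1"
  then have "\<not> 3 dvd u" "\<not> 3 dvd v" "\<not> 3 dvd w"
    using not_dvd_of_dvd_mult_plus_one[of 3 u v 3] not_dvd_of_dvd_mult_plus_one[of 3 v w 3]
      not_dvd_of_dvd_mult_plus_one[of 3 w v 3] by (simp_all add: mult.commute)
  moreover from this have "u mod 3 \<noteq> v mod 3" "v mod 3 \<noteq> w mod 3" "u mod 3 \<noteq> w mod 3"
    using * three_dvd_mult_plus_one_iff by blast+
  ultimately show False by presburger
qed

lemma four_dvd_triangle:
  fixes u v w :: int
  shows "\<not> (4 dvd u * v + 1 \<and> 4 dvd v * w + 1 \<and> 4 dvd u * w + 1)"
proof
  assume *: "4 dvd u * v + 1 \<and> 4 dvd v * w + 1 \<and> 4 dvd u * w + 1"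
  then have "odd u" "odd v" "odd w"
    using not_dvd_of_dvd_mult_plus_one[of 4 u v 2] not_dvd_of_dvd_mult_plus_one[of 4 v w 2]
      not_dvd_of_dvd_mult_plus_one[of 4 w v 2] by (simp_all add: mult.commute)
  moreover from this have "u mod 4 \<noteq> v mod 4" "v mod 4 \<noteq> w mod 4" "u mod 4 \<noteq> w mod 4"
    using * four_dvd_mult_plus_one_iff by blast+
  ultimately show False by presburger
qed

text \<open>If \<open>u\<close> is even, 3 divides all values at \<open>u\<close>. By
  \<open>three_dvd_triangle\<close> it then divides none of the other three, so 4 divides all of
  these, against \<open>four_dvd_triangle\<close>. For 3 the roles are swapped.\<close>

lemma coprime_to_six_of_quadruple:
  fixes u v w x :: int
  assumes e: "3 dvd u * v + 1 \<or> 4 dvd u * v + 1" "3 dvd u * w + 1 \<or> 4 dvd u * w + 1"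
    "3 dvd u * x + 1 \<or> 4 dvd u * x + 1" "3 dvd v * w + 1 \<or> 4 dvd v * w + 1"
    "3 dvd v * x + 1 \<or> 4 dvd v * x + 1" "3 dvd w * x + 1 \<or> 4 dvd w * x + 1"
  shows "odd u" "\<not> 3 dvd u"
proof -
  show "odd u"
  proof
    assume "even u"
    then have "\<not> 4 dvd u * s + 1" for s
      using not_dvd_of_dvd_mult_plus_one[of 4 u s 2] by auto
    then show False using e three_dvd_triangle[of u v w] three_dvd_triangle[of u v x]
        three_dvd_triangle[of u w x] four_dvd_triangle[of v w x] by blast
  qed
  show "\<not> 3 dvd u"
  proof
    assume "3 dvd u"
    then have "\<not> 3 dvd u * s + 1" for s
      using not_dvd_of_dvd_mult_plus_one[of 3 u s 3] by auto
    then show False using e four_dvd_triangle[of u v w] four_dvd_triangle[of u v x]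
        four_dvd_triangle[of u w x] three_dvd_triangle[of v w x] by blast
  qed
qed

section \<open>Integers of the form \<open>2 ^ x * 3 ^ y\<close>\<close>

definition two_three_unit :: "int \<Rightarrow> bool" where
  "two_three_unit s \<longleftrightarrow> (\<exists>x y. s = 2 ^ x * 3 ^ y)"

lemma two_three_unit_of_S_unit:
  assumes "S_unit {2, 3} n"
  shows "two_three_unit (int n)"
proof -
  have n: "n > 0" "prime_factors n \<subseteq> {2, 3}" using assms by (auto simp: S_unit_def)
  have "n = (\<Prod>p\<in>prime_factors n. p ^ multiplicity p n)"
    using n by (simp add: prime_factorization_nat)
  \<comment> \<open>A prime among 2 and 3 that does not divide \<open>n\<close> has multiplicity 0
    and contributes the factor 1.\<close>
  also have "\<dots> = (\<Prod>p\<in>{2, 3}. p ^ multiplicity p n)"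
    using n by (intro prod.mono_neutral_left)
      (auto simp: prime_factors_multiplicity)
  also have "\<dots> = 2 ^ multiplicity 2 n * 3 ^ multiplicity 3 n" by simp
  finally have "int n = 2 ^ multiplicity 2 n * 3 ^ multiplicity 3 n"
    by (metis of_nat_mult of_nat_numeral of_nat_power)
  then show ?thesis unfolding two_three_unit_def by blast
qed

lemma two_three_unit_dvd:
  assumes "two_three_unit s" "s > 2"
  shows "3 dvd s \<or> 4 dvd s"
proof -
  obtain x y where s: "s = 2 ^ x * 3 ^ y" using assms two_three_unit_def by auto
  show ?thesis
  proof (cases "y = 0")
    case True
    have "x \<noteq> 0" "x \<noteq> 1" using True s assms(2)
      by (metis less_irrefl less_trans mult.right_neutral one_less_numeral_iff power_0
          power_one_right semiring_norm(76))+
    then have "(2::int) ^ 2 dvd 2 ^ x" by (intro le_imp_power_dvd) simp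
    then show ?thesis using s by simp
  qed (simp add: s)
qed

lemma even_two_three_unit:
  assumes "two_three_unit s" "even s"
  obtains x y where "s = 2 * 2 ^ x * 3 ^ y"
proof -
  obtain x y where s: "s = 2 ^ x * 3 ^ y" using assms two_three_unit_def by auto
  then have "x \<noteq> 0" using assms by (auto simp: even_mult_iff)
  then have "s = 2 * 2 ^ (x - 1) * 3 ^ y" by (simp add: s flip: power_Suc)
  then show thesis by (rule that)
qed

lemma even_two_three_unit_not_three_dvd:
  assumes "two_three_unit s" "even s" "\<not> 3 dvd s"
  obtains x where "s = 2 * 2 ^ x"
proof -
  obtain x y where s: "s = 2 * 2 ^ x * 3 ^ y" using even_two_three_unit assms by metis
  then have "y = 0" using assms by (cases y) auto
  then show thesis using s that by simp
qed

lemma even_two_three_unit_not_four_dvd: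
  assumes "two_three_unit s" "even s" "\<not> 4 dvd s"
  obtains y where "s = 2 * 3 ^ y"
proof -
  obtain x y where s: "s = 2 * 2 ^ x * 3 ^ y" using even_two_three_unit assms by metis
  then have "x = 0" using assms by (cases x) auto
  then show thesis using s that by simp
qed

section \<open>Arrangement of the residues in an ordered quadruple\<close>

lemma no_ordered_quadruple:
  fixes a b c d :: int
  assumes ord: "0 < a" "a < b" "b < c" "c < d"
    and units: "two_three_unit (a * b + 1)" "two_three_unit (a * c + 1)" "two_three_unit (a * d + 1)"
      "two_three_unit (b * c + 1)" "two_three_unit (b * d + 1)" "two_three_unit (c * d + 1)"
  shows False
proof -
  have gt: "r * s + 1 > 2" if "0 < r" "r < s" for r s :: int
  proof -
    have "1 * s \<le> r * s" using that by (intro mult_right_mono) auto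
    then show ?thesis using that by linarith
  qed
  have dvd: "3 dvd r * s + 1 \<or> 4 dvd r * s + 1" if "0 < r" "r < s" "two_three_unit (r * s + 1)" for r s
    using that gt two_three_unit_dvd by blast
  have edge: "3 dvd r * s + 1 \<or> 4 dvd r * s + 1"
    if "r \<in> {a, b, c, d}" "s \<in> {a, b, c, d}" "r \<noteq> s" for r s
    using that ord units dvd[of r s] dvd[of s r] by (auto simp: mult.commute)
  have cop: "odd r" "\<not> 3 dvd r" if r: "r \<in> {a, b, c, d}" for r
  proof -
    have "\<exists>v w x. distinct [r, v, w, x] \<and> {v, w, x} \<subseteq> {a, b, c, d}"
    proof -
      consider "r = a" | "r = b" | "r = c" | "r = d" using r by auto
      then show ?thesis
      proof cases
        case 1 then show ?thesis using ord by (intro exI[of _ b] exI[of _ c] exI[of _ d]) auto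
      next
        case 2 then show ?thesis using ord by (intro exI[of _ a] exI[of _ c] exI[of _ d]) auto
      next
        case 3 then show ?thesis using ord by (intro exI[of _ a] exI[of _ b] exI[of _ d]) auto
      next
        case 4 then show ?thesis using ord by (intro exI[of _ a] exI[of _ b] exI[of _ c]) auto
      qed
    qed
    then obtain v w x where vwx: "distinct [r, v, w, x]" "v \<in> {a, b, c, d}" "w \<in> {a, b, c, d}"
      "x \<in> {a, b, c, d}" by blast
    show "odd r" "\<not> 3 dvd r"
      by (rule coprime_to_six_of_quadruple[of r v w x]; rule edge; use vwx r in simp)+
  qed
  have pow2: "\<exists>x. r * s + 1 = 2 * 2 ^ x"
    if "two_three_unit (r * s + 1)" "r \<in> {a, b, c, d}" "s \<in> {a, b, c, d}" "r mod 3 = s mod 3" for r s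
    using even_two_three_unit_not_three_dvd[of "r * s + 1"] three_dvd_mult_plus_one_iff[of r s]
      cop that by (metis even_mult_iff odd_even_add odd_one)
  have pow3: "\<exists>x. r * s + 1 = 2 * 3 ^ x"
    if "two_three_unit (r * s + 1)" "r \<in> {a, b, c, d}" "s \<in> {a, b, c, d}" "r mod 4 = s mod 4" for r s
    using even_two_three_unit_not_four_dvd[of "r * s + 1"] four_dvd_mult_plus_one_iff[of r s]
      cop that by (metis even_mult_iff odd_even_add odd_one)
  have mixed: "\<exists>x y. r * s + 1 = 2 * 2 ^ x * 3 ^ y"
    if "two_three_unit (r * s + 1)" "r \<in> {a, b, c, d}" "s \<in> {a, b, c, d}" for r s
    using even_two_three_unit[of "r * s + 1"] cop that by (metis even_mult_iff odd_even_add odd_one)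
  \<comment> \<open>If both residues agreed, neither 3 nor 4 would divide
    \<open>r * s + 1\<close>.\<close>
  have distinct: "r mod 3 \<noteq> s mod 3 \<or> r mod 4 \<noteq> s mod 4"
    if "r \<in> {a, b, c, d}" "s \<in> {a, b, c, d}" "r \<noteq> s" for r s
    using edge[OF that] cop[OF that(1)] cop[OF that(2)]
      three_dvd_mult_plus_one_iff four_dvd_mult_plus_one_iff by blast
  have mod3: "r mod 3 = 1 \<or> r mod 3 = 2" and mod4: "r mod 4 = 1 \<or> r mod 4 = 3"
    if "r \<in> {a, b, c, d}" for r
    using cop[OF that] by presburger+

  \<comment> \<open>Here \<open>u\<close> and \<open>v\<close> are the partners of \<open>d\<close>
    modulo 3 and modulo 4, so \<open>w\<close> is its mixed partner. For \<open>w\<close> equal to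
    \<open>b\<close> or \<open>c\<close> the differences are too small for
    \<open>mixed_value_bound\<close>.\<close>
  have no_mixed: False
    if mem: "u \<in> {a, b, c}" "v \<in> {a, b, c}" "w \<in> {b, c}"
      and ne: "u \<noteq> w" "v \<noteq> w" "u \<noteq> v" and eq: "u mod 3 = d mod 3" "v mod 4 = d mod 4"
    for u v w
  proof -
    have unit: "two_three_unit (r * d + 1)" if "r \<in> {a, b, c}" for r using that units by auto
    have bounds: "0 < r" "r < d" if "r \<in> {a, b, c}" for r using that ord by auto
    obtain A where A: "u * d + 1 = 2 * 2 ^ A" using pow2[OF unit[OF mem(1)] _ _ eq(1)] mem by blast
    obtain C where C: "v * d + 1 = 2 * 3 ^ C" using pow3[OF unit[OF mem(2)] _ _ eq(2)] mem by blast
    obtain E F where EF: "w * d + 1 = 2 * 2 ^ E * 3 ^ F" using mixed[OF unit, of w] mem by blast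
    have "2 * (w * d + 1) \<le> \<bar>u - w\<bar> * \<bar>v - w\<bar>"
      using bounds mem ne by (intro mixed_value_bound[OF _ _ _ _ _ _ _ _ _ _ A C EF]) auto
    moreover have "\<bar>u - w\<bar> * \<bar>v - w\<bar> \<le> w * d"
    proof -
      have "w = b \<or> w = c" using mem by auto
      moreover have "u = a \<and> v = c \<or> u = c \<and> v = a" if "w = b"
        using that ne mem by blast
      ultimately consider "w = c" | "w = b" "u = a" "v = c" | "w = b" "u = c" "v = a" by blast
      then show ?thesis
      proof cases
        case 1
        then have "\<bar>u - w\<bar> \<le> w" "\<bar>v - w\<bar> \<le> d" using mem ord by auto
        then show ?thesis using ord 1 by (intro mult_mono) auto
      next
        case 2
        then show ?thesis using ord by (intro mult_mono) auto
      next
        case 3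
        have "\<bar>v - w\<bar> * \<bar>u - w\<bar> \<le> w * d" using ord 3 by (intro mult_mono) auto
        then show ?thesis by (simp add: mult.commute)
      qed
    qed
    moreover have "0 < w * d" using mem ord by auto
    ultimately show False unfolding distrib_left by linarith
  qed

  have mems: "a \<in> {a, b, c, d}" "b \<in> {a, b, c, d}" "c \<in> {a, b, c, d}" "d \<in> {a, b, c, d}" by auto
  have "\<not> (c mod 3 = d mod 3 \<and> a mod 4 = d mod 4)" "\<not> (a mod 3 = d mod 3 \<and> c mod 4 = d mod 4)"
    "\<not> (b mod 3 = d mod 3 \<and> a mod 4 = d mod 4)" "\<not> (a mod 3 = d mod 3 \<and> b mod 4 = d mod 4)"
    using no_mixed[of c a b] no_mixed[of a c b] no_mixed[of b a c] no_mixed[of a b c] ord by auto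
  moreover have "a \<noteq> b" "a \<noteq> c" "a \<noteq> d" "b \<noteq> c" "b \<noteq> d" "c \<noteq> d" using ord by auto
  note ds = distinct[OF mems(1,2) this(1)] distinct[OF mems(1,3) this(2)] distinct[OF mems(1,4) this(3)]
    distinct[OF mems(2,3) this(4)] distinct[OF mems(2,4) this(5)] distinct[OF mems(3,4) this(6)]
  \<comment> \<open>Only \<open>a\<close> remains as mixed partner of \<open>d\<close>; the two
    cases say which of \<open>b\<close> and \<open>c\<close> agrees with \<open>d\<close> modulo
    3.\<close>
  ultimately consider
      "a mod 3 = b mod 3" "c mod 3 = d mod 3" "a mod 4 = c mod 4" "b mod 4 = d mod 4"
    | "a mod 4 = b mod 4" "c mod 4 = d mod 4" "a mod 3 = c mod 3" "b mod 3 = d mod 3"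
    using mod3[OF mems(1)] mod3[OF mems(2)] mod3[OF mems(3)] mod3[OF mems(4)]
      mod4[OF mems(1)] mod4[OF mems(2)] mod4[OF mems(3)] mod4[OF mems(4)] ds
    by smt
  then show False
  proof cases
    case 1
    obtain A B C D E F G H where
      "a * b + 1 = 2 * 2 ^ A" "c * d + 1 = 2 * 2 ^ B" "a * c + 1 = 2 * 3 ^ C" "b * d + 1 = 2 * 3 ^ D"
      "a * d + 1 = 2 * 2 ^ E * 3 ^ F" "b * c + 1 = 2 * 2 ^ G * 3 ^ H"
      using 1 pow2 pow3 mixed units mems by meson
    then show False by (intro no_coprime_quadruple[of 2 3 a b c d]) (use ord in auto)
  next
    case 2
    \<comment> \<open>Now \<open>p = 3\<close> and \<open>q = 2\<close>, so \<open>E\<close> and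
      \<open>G\<close> are exponents of 3.\<close>
    obtain A B C D E F G H where
      "a * b + 1 = 2 * 3 ^ A" "c * d + 1 = 2 * 3 ^ B" "a * c + 1 = 2 * 2 ^ C" "b * d + 1 = 2 * 2 ^ D"
      "a * d + 1 = 2 * 2 ^ F * 3 ^ E" "b * c + 1 = 2 * 2 ^ H * 3 ^ G"
      using 2 pow2 pow3 mixed units mems by meson
    then show False
      by (intro no_coprime_quadruple[of 3 2 a b c d A B C D E F G H]) (use ord in \<open>auto simp: ac_simps\<close>)
  qed
qed

theorem theorem3:
  shows "\<not> (\<exists>a\<^sub>1 a\<^sub>2 a\<^sub>3 a\<^sub>4 :: nat. S_Diophantine_quadruple {2, 3} [a\<^sub>1, a\<^sub>2, a\<^sub>3, a\<^sub>4])"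
proof
  assume "\<exists>a\<^sub>1 a\<^sub>2 a\<^sub>3 a\<^sub>4 :: nat. S_Diophantine_quadruple {2, 3} [a\<^sub>1, a\<^sub>2, a\<^sub>3, a\<^sub>4]"
  then obtain as :: "nat list" where as: "S_Diophantine_quadruple {2, 3} as" by blast
  \<comment> \<open>The condition is symmetric in the entries, so they may be sorted; distinctness
    makes the order strict.\<close>
  define bs where "bs = sort as"
  have len: "length bs = 4" and "distinct bs" "sorted bs" and pos: "\<forall>r\<in>set bs. 0 < r"
    and set: "set bs = set as"
    using as by (auto simp: S_Diophantine_quadruple_def bs_def)
  have lt: "bs ! i < bs ! j" if "i < j" "j < 4" for i j
    using that len \<open>distinct bs\<close> \<open>sorted bs\<close>
    by (metis sorted_wrt_nth_less strict_sorted_iff)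
  have unit: "two_three_unit (int (bs ! i) * int (bs ! j) + 1)" if "i < j" "j < 4" for i j
  proof -
    have "bs ! i \<in> set as" "bs ! j \<in> set as" using that len by (simp_all flip: set)
    then obtain k l where "k < 4" "l < 4" "bs ! i = as ! k" "bs ! j = as ! l"
      using as unfolding S_Diophantine_quadruple_def by (metis in_set_conv_nth)
    moreover from this have "k \<noteq> l" using lt[OF that] by auto
    ultimately have "S_unit {2, 3} (bs ! i * bs ! j + 1)"
      using as unfolding S_Diophantine_quadruple_def by simp
    from two_three_unit_of_S_unit[OF this] show ?thesis by (simp add: add.commute)
  qed
  show False
  proof (rule no_ordered_quadruple[of "int (bs ! 0)" "int (bs ! 1)" "int (bs ! 2)" "int (bs ! 3)"])
    show "0 < int (bs ! 0)" using pos len by simp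
  qed (use lt unit in auto)
qed

end
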